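(* For any $\alpha\ge 1$, there are $n$-node directed graphs $G$ such that any $\alpha$-stretch shortest-paths preserving graph $H$ of $G$ has aspect ratio $2^{\Omega(n)}$.
   Context: The aspect ratio of a graph with positive edge weights $w$ is $\max_e w(e)/\min_e w(e)$. Given a graph $G=(V,E,w_G)$, a reweighted graph $H=(V,E,w_H)$ on the same vertex and edge set with positive weights is called $\alpha$-stretch shortest-paths preserving if every shortest path in $H$ is an $\alpha$-approximate shortest path in $G$, i.e. if $\pi$ is a shortest $s\leadsto t$ path in $H$ then $w_G(\pi)\le \alpha\cdot \mathrm{dist}_G(s,t)$. The bound $2^{\Omega(n)}$ means: there is an absolute constant $c>0$ (independent of $\alpha$) such that for infinitely many $n$ such a graph exists with every such $H$ having aspect ratio at least $2^{cn}$. *)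

theory Defs
  imports Complex_Main "HOL-Library.Infinite_Set" "Graph_Theory.Graph_Theory"
begin

context wf_digraph
begin

text \<open>
  \<^term>\<open>\<mu> w s t\<close> is the distance from \<^term>\<open>s\<close> to \<^term>\<open>t\<close>, an extended real which is
  infinite if \<^term>\<open>t\<close> is not reachable from \<^term>\<open>s\<close>.
\<close>

definition shortest_path :: "'b weight_fun \<Rightarrow> 'a \<Rightarrow> 'b awalk \<Rightarrow> 'a \<Rightarrow> bool" where
  "shortest_path w s p t \<longleftrightarrow> apath s p t \<and> ereal (awalk_cost w p) = \<mu> w s t"

definition approx_shortest_path ::
  "real \<Rightarrow> 'b weight_fun \<Rightarrow> 'a \<Rightarrow> 'b awalk \<Rightarrow> 'a \<Rightarrow> bool" where
  "approx_shortest_path \<alpha> w s p t \<longleftrightarrow>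
     apath s p t \<and> ereal (awalk_cost w p) \<le> ereal \<alpha> * \<mu> w s t"

definition positive_weights :: "'b weight_fun \<Rightarrow> bool" where
  "positive_weights w \<longleftrightarrow> (\<forall>e \<in> arcs G. 0 < w e)"

text \<open>
  A reweighted graph has the same vertices and arcs, so it is given by its weight function
  \<^term>\<open>w\<^sub>H\<close> alone, on the digraph fixed by the locale.
\<close>

definition shortest_paths_preserving ::
  "real \<Rightarrow> 'b weight_fun \<Rightarrow> 'b weight_fun \<Rightarrow> bool" where
  "shortest_paths_preserving \<alpha> w\<^sub>G w\<^sub>H \<longleftrightarrow>
     positive_weights w\<^sub>H \<and>
     (\<forall>s p t. shortest_path w\<^sub>H s p t \<longrightarrow> approx_shortest_path \<alpha> w\<^sub>G s p t)"

text \<open>Only meaningful if there is at least one arc.\<close>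

definition aspect_ratio :: "'b weight_fun \<Rightarrow> real" where
  "aspect_ratio w = (MAX e \<in> arcs G. w e) / (MIN e \<in> arcs G. w e)"

end

end

(*
  Two outgoing chains Out b 0, Out b 1, ... start at Root and two incoming chains end there, the
  incoming ones switching sides at every level: In b (i+1) is followed by In (~b) i.  Rungs lead
  from Out b i to In b i; in G they cost (5 alpha)^(i+1), all other arcs cost 1.  A path from
  Out b i to In (~b) i that avoids the rungs above level i has to take the rung b i, descend to
  Root, climb to Out (~b) i and take the rung (~b) i.  The detour over the rung b (i+1) is too
  expensive in G, so it must be strictly longer than such a path in H.  Completing both routes to
  closed tours through Root shows that the H-cost of the tour over the rung b (i+1) exceeds the
  sum of the costs of the two tours at level i; hence tour costs at least double per level, although
  a tour has only linearly many arcs.  Comparing closed tours makes the argument insensitive to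
  the weights that H gives to the chains.
*)

theory Submission
  imports Defs "HOL-Library.Countable"
begin

section \<open>Bounds on walk costs in weighted digraphs\<close>

text \<open>Telescoping along the walk. Feasibility is demanded only on the arcs of
  \<open>p\<close>, so arcs known to be avoided by \<open>p\<close> may violate it.\<close>

lemma (in wf_digraph) potential_le_awalk_cost:
  fixes \<phi> :: "'a \<Rightarrow> real"
  assumes "awalk u p v" and "\<And>e. e \<in> set p \<Longrightarrow> \<phi> (head G e) \<le> \<phi> (tail G e) + w e"
  shows "\<phi> v \<le> \<phi> u + awalk_cost w p"
  using assms
proof (induction p arbitrary: u)
  case Nil
  then show ?case by (simp add: awalk_Nil_iff)
next
  case (Cons e p)
  have "\<phi> v \<le> \<phi> (head G e) + awalk_cost w p"
    using Cons.prems by (intro Cons.IH) (auto simp: awalk_Cons_iff)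
  moreover have "\<phi> (head G e) \<le> \<phi> u + w e"
    using Cons.prems by (force simp: awalk_Cons_iff)
  ultimately show ?case by simp
qed

lemma (in wf_digraph) arc_weight_le_awalk_cost:
  assumes "positive_weights w" and "set p \<subseteq> arcs G" and "e \<in> set p"
  shows "w e \<le> awalk_cost w p"
  unfolding awalk_cost_def
  using assms by (intro member_le_sum_list) (auto simp: positive_weights_def intro: less_imp_le)

section \<open>The ladder digraph\<close>

datatype node = Root | Out bool nat | In bool nat

instance node :: countable
  by countable_datatype

inductive ladder_arc :: "nat \<Rightarrow> node \<Rightarrow> node \<Rightarrow> bool" for k where
  "ladder_arc k Root (Out b 0)"
| "i < k \<Longrightarrow> ladder_arc k (Out b i) (Out b (Suc i))"
| "i \<le> k \<Longrightarrow> ladder_arc k (Out b i) (In b i)"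
| "i < k \<Longrightarrow> ladder_arc k (In b (Suc i)) (In (\<not> b) i)"
| "ladder_arc k (In b 0) Root"

definition ladder_nodes :: "nat \<Rightarrow> node set" where
  "ladder_nodes k = insert Root (case_prod Out ` (UNIV \<times> {..k}) \<union> case_prod In ` (UNIV \<times> {..k}))"

text \<open>The theorem speaks of digraphs on natural numbers, hence the numbering by
  \<open>to_nat\<close>; all combinatorics is done on the type \<open>node\<close>.\<close>

definition ladder :: "nat \<Rightarrow> nat pair_pre_digraph" where
  "ladder k = \<lparr>pverts = to_nat ` ladder_nodes k,
     parcs = {(to_nat u, to_nat v) | u v. ladder_arc k u v}\<rparr>"

lemma ladder_nodes_simps [simp]:
  "Root \<in> ladder_nodes k" "Out b i \<in> ladder_nodes k \<longleftrightarrow> i \<le> k" "In b i \<in> ladder_nodes k \<longleftrightarrow> i \<le> k"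
  by (auto simp: ladder_nodes_def)

lemma finite_ladder_nodes: "finite (ladder_nodes k)"
  by (simp add: ladder_nodes_def)

lemma card_ladder_nodes: "card (ladder_nodes k) = 4 * k + 5"
proof -
  have "card (case_prod Out ` (UNIV \<times> {..k})) = 2 * (k + 1)"
    "card (case_prod In ` (UNIV \<times> {..k})) = 2 * (k + 1)"
    by (subst card_image; force simp: inj_on_def card_cartesian_product)+
  moreover have "card (ladder_nodes k) =
    Suc (card (case_prod Out ` (UNIV \<times> {..k}) \<union> case_prod In ` (UNIV \<times> {..k})))"
    unfolding ladder_nodes_def by (subst card_insert_disjoint) auto
  moreover have "card (case_prod Out ` (UNIV \<times> {..k}) \<union> case_prod In ` (UNIV \<times> {..k})) =
    card (case_prod Out ` (UNIV \<times> {..k})) + card (case_prod In ` (UNIV \<times> {..k}))"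
    by (intro card_Un_disjoint) auto
  ultimately show ?thesis by simp
qed

lemma pverts_ladder: "pverts (ladder k) = to_nat ` ladder_nodes k"
  by (simp add: ladder_def)

lemma card_pverts_ladder: "card (pverts (ladder k)) = 4 * k + 5"
  by (simp add: pverts_ladder card_image card_ladder_nodes)

lemma ladder_arc_nodes:
  assumes "ladder_arc k u v"
  shows "u \<in> ladder_nodes k" "v \<in> ladder_nodes k" "u \<noteq> v"
  using assms by (auto elim: ladder_arc.cases)

lemma parcs_ladder_iff [simp]: "(to_nat u, to_nat v) \<in> parcs (ladder k) \<longleftrightarrow> ladder_arc k u v"
  by (auto simp: ladder_def)

lemma parcs_ladderE:
  assumes "e \<in> parcs (ladder k)"
  obtains u v where "e = (to_nat u, to_nat v)" "ladder_arc k u v"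
  using assms by (auto simp: ladder_def)

lemma to_nat_in_pverts [simp]: "to_nat u \<in> pverts (ladder k) \<longleftrightarrow> u \<in> ladder_nodes k"
  by (auto simp: pverts_ladder)

interpretation ladder: pair_digraph "ladder k" for k
proof
  have "parcs (ladder k) \<subseteq> pverts (ladder k) \<times> pverts (ladder k)"
    by (auto simp: ladder_arc_nodes elim!: parcs_ladderE)
  moreover show "finite (pverts (ladder k))"
    by (simp add: pverts_ladder finite_ladder_nodes)
  ultimately show "finite (parcs (ladder k))"
    by (meson finite_SigmaI finite_subset)
qed (auto elim!: parcs_ladderE dest: ladder_arc_nodes)

section \<open>Chains, tours and the route between the two sides\<close>

definition node_weight :: "(nat \<times> nat) weight_fun \<Rightarrow> node \<Rightarrow> node \<Rightarrow> real" where
  "node_weight w u v = w (to_nat u, to_nat v)"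

fun out_cost :: "(nat \<times> nat) weight_fun \<Rightarrow> bool \<Rightarrow> nat \<Rightarrow> real" where
  "out_cost w b 0 = node_weight w Root (Out b 0)"
| "out_cost w b (Suc i) = out_cost w b i + node_weight w (Out b i) (Out b (Suc i))"

fun in_cost :: "(nat \<times> nat) weight_fun \<Rightarrow> bool \<Rightarrow> nat \<Rightarrow> real" where
  "in_cost w b 0 = node_weight w (In b 0) Root"
| "in_cost w b (Suc i) = node_weight w (In b (Suc i)) (In (\<not> b) i) + in_cost w (\<not> b) i"

text \<open>The closed tour through \<open>Root\<close> whose only rung is the one from
  \<open>Out b i\<close> to \<open>In b i\<close>; it has 2i + 3 arcs.\<close>

definition tour_cost :: "(nat \<times> nat) weight_fun \<Rightarrow> bool \<Rightarrow> nat \<Rightarrow> real" where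
  "tour_cost w b i = out_cost w b i + node_weight w (Out b i) (In b i) + in_cost w b i"

lemma out_walk:
  assumes "i \<le> k"
  shows "\<exists>p. ladder.awalk k (to_nat Root) p (to_nat (Out b i)) \<and>
    ladder.awalk_cost w p = out_cost w b i"
  using assms
proof (induction i)
  case 0
  then show ?case
    by (intro exI[of _ "[(to_nat Root, to_nat (Out b 0))]"])
      (auto simp: ladder.awalk_simps node_weight_def intro: ladder_arc.intros)
next
  case (Suc i)
  then obtain p where "ladder.awalk k (to_nat Root) p (to_nat (Out b i))"
    "ladder.awalk_cost w p = out_cost w b i" by auto
  then show ?case using Suc.prems
    by (intro exI[of _ "p @ [(to_nat (Out b i), to_nat (Out b (Suc i)))]"])
      (auto simp: ladder.awalk_simps node_weight_def intro!: ladder.awalk_appendI ladder_arc.intros)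
qed

lemma in_walk:
  assumes "i \<le> k"
  shows "\<exists>p. ladder.awalk k (to_nat (In b i)) p (to_nat Root) \<and>
    ladder.awalk_cost w p = in_cost w b i"
  using assms
proof (induction i arbitrary: b)
  case 0
  then show ?case
    by (intro exI[of _ "[(to_nat (In b 0), to_nat Root)]"])
      (auto simp: ladder.awalk_simps node_weight_def intro: ladder_arc.intros)
next
  case (Suc i)
  then obtain p where "ladder.awalk k (to_nat (In (\<not> b) i)) p (to_nat Root)"
    "ladder.awalk_cost w p = in_cost w (\<not> b) i" using Suc.IH[of "\<not> b"] by auto
  then show ?case using Suc.prems
    by (intro exI[of _ "(to_nat (In b (Suc i)), to_nat (In (\<not> b) i)) # p"])
      (auto simp: ladder.awalk_simps node_weight_def intro!: ladder_arc.intros)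
qed

text \<open>Used to bound a distance in G from above, for which a walk is enough.\<close>

lemma cross_walk:
  assumes "i \<le> k"
  shows "\<exists>p. ladder.awalk k (to_nat (Out b i)) p (to_nat (In (\<not> b) i)) \<and>
    ladder.awalk_cost w p = node_weight w (Out b i) (In b i) + in_cost w b i +
      out_cost w (\<not> b) i + node_weight w (Out (\<not> b) i) (In (\<not> b) i)"
proof -
  obtain p q where "ladder.awalk k (to_nat (In b i)) p (to_nat Root)"
    "ladder.awalk_cost w p = in_cost w b i"
    "ladder.awalk k (to_nat Root) q (to_nat (Out (\<not> b) i))"
    "ladder.awalk_cost w q = out_cost w (\<not> b) i"
    using out_walk[OF assms] in_walk[OF assms] by metis
  then show ?thesis using assms
    by (intro exI[of _ "(to_nat (Out b i), to_nat (In b i)) # p @ q @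
          [(to_nat (Out (\<not> b) i), to_nat (In (\<not> b) i))]"])
      (auto simp: ladder.awalk_simps node_weight_def
        intro!: ladder_arc.intros ladder.awalk_appendI)
qed

section \<open>The weights of G\<close>

definition steep_weight :: "real \<Rightarrow> (nat \<times> nat) weight_fun" where
  "steep_weight \<alpha> e = (case (from_nat (fst e), from_nat (snd e)) of
     (Out b i, In c j) \<Rightarrow> (5 * \<alpha>) ^ Suc i | _ \<Rightarrow> 1)"

lemma steep_weight_pos:
  assumes "\<alpha> \<ge> 1"
  shows "ladder.positive_weights k (steep_weight \<alpha>)"
  unfolding ladder.positive_weights_def
  using assms by (auto simp: steep_weight_def split: node.split)

lemma steep_cost:
  "out_cost (steep_weight \<alpha>) b i = 1 + real i"
  "in_cost (steep_weight \<alpha>) b i = 1 + real i"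
  "node_weight (steep_weight \<alpha>) (Out b i) (In c j) = (5 * \<alpha>) ^ Suc i"
  by (induction i arbitrary: b) (auto simp: steep_weight_def node_weight_def)

text \<open>The left side is \<alpha> times the G-cost of the route in \<open>cross_walk\<close>.
  Its chain arcs cost no more than its two rungs, so the route costs at most 4 (5\<alpha>)^(i+1),
  and 4\<alpha> < 5\<alpha> gives strictness. This is what dictates the base 5\<alpha>.\<close>

lemma steep_rung_dominates:
  fixes \<alpha> :: real
  assumes "\<alpha> \<ge> 1" "i < j"
  shows "\<alpha> * (2 * (5 * \<alpha>) ^ Suc i + 2 * (1 + real i)) < (5 * \<alpha>) ^ Suc j"
proof -
  have "1 + real i \<le> 2 ^ Suc i"
    using less_exp[of "Suc i"] by (metis less_imp_le of_nat_Suc of_nat_le_numeral_power_cancel_iff add.commute)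
  also have "\<dots> \<le> (5 * \<alpha>) ^ Suc i"
    using assms by (intro power_mono) auto
  finally have "2 * (5 * \<alpha>) ^ Suc i + 2 * (1 + real i) \<le> 4 * (5 * \<alpha>) ^ Suc i"
    by (simp only: mult_2)
  then have "\<alpha> * (2 * (5 * \<alpha>) ^ Suc i + 2 * (1 + real i)) \<le> \<alpha> * (4 * (5 * \<alpha>) ^ Suc i)"
    using assms(1) by (intro mult_left_mono) auto
  also have "\<dots> < (5 * \<alpha>) * (5 * \<alpha>) ^ Suc i"
    using assms by simp
  also have "\<dots> = (5 * \<alpha>) ^ Suc (Suc i)" by simp
  also have "\<dots> \<le> (5 * \<alpha>) ^ Suc j"
    using assms by (intro power_increasing) auto
  finally show ?thesis .
qed

section \<open>Routes in H that avoid the high rungs\<close>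

lemma node_weight_pos:
  assumes "ladder.positive_weights k w" "ladder_arc k u v"
  shows "0 < node_weight w u v"
  using assms by (simp add: ladder.positive_weights_def node_weight_def)

lemma out_cost_pos:
  assumes "ladder.positive_weights k w" "i \<le> k"
  shows "0 < out_cost w b i"
  using assms(2)
  by (induction i) (auto intro!: add_pos_pos node_weight_pos[OF assms(1)] ladder_arc.intros)

lemma in_cost_pos:
  assumes "ladder.positive_weights k w" "i \<le> k"
  shows "0 < in_cost w b i"
  using assms(2)
  by (induction i arbitrary: b)
    (auto intro!: add_pos_pos node_weight_pos[OF assms(1)] ladder_arc.intros)

text \<open>By duality: a feasible potential that is 0 at the start and equals the cost of the
  intended route at the end bounds all admissible walks at once, without an analysis of their
  shapes.\<close>

lemma cross_cost_le:
  assumes pos: "ladder.positive_weights k w" and i: "i \<le> k"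
    and p: "ladder.awalk k (to_nat (Out b i)) p (to_nat (In (\<not> b) i))"
    and low: "\<And>c j. (to_nat (Out c j), to_nat (In c j)) \<in> set p \<Longrightarrow> j \<le> i"
  shows "node_weight w (Out b i) (In b i) + in_cost w b i + out_cost w (\<not> b) i +
    node_weight w (Out (\<not> b) i) (In (\<not> b) i) \<le> ladder.awalk_cost w p"
proof -
  \<comment> \<open>\<open>S\<close> is the cost of the intended route up to \<open>Root\<close>,
    \<open>T\<close> that of the whole route.\<close>
  define S where "S = node_weight w (Out b i) (In b i) + in_cost w b i"
  define T where "T = S + out_cost w (\<not> b) i + node_weight w (Out (\<not> b) i) (In (\<not> b) i)"
  \<comment> \<open>The cost of the intended route up to a node, extended to the nodes off that route
    so that it is feasible on every arc except the rungs above level \<open>i\<close>.\<close>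
  define \<phi> where "\<phi> u = (case u of Root \<Rightarrow> S
     | Out c j \<Rightarrow> if c = b \<and> i \<le> j then 0 else S + out_cost w c j
     | In c j \<Rightarrow> if j < i \<or> j = i \<and> c = b then S - in_cost w c j else T)" for u
  have rung: "0 < node_weight w (Out c j) (In c j)" if "j \<le> k" for c j
    using that by (intro node_weight_pos[OF pos] ladder_arc.intros)
  have S: "0 < S"
    unfolding S_def by (intro add_pos_pos rung in_cost_pos[OF pos] i)
  have T: "S < T"
    using rung[OF i, of "\<not> b"] out_cost_pos[OF pos i, of "\<not> b"] by (simp add: T_def)
  have step: "\<phi> v \<le> \<phi> u + node_weight w u v"
    if uv: "ladder_arc k u v" and r: "\<And>c j. u = Out c j \<Longrightarrow> v = In c j \<Longrightarrow> j \<le> i" for u v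
    using uv
  proof cases
    case (1 c)
    then show ?thesis using S node_weight_pos[OF pos uv] by (auto simp: \<phi>_def)
  next
    case (2 j c)
    have "0 < out_cost w c j" using 2 by (intro out_cost_pos[OF pos]) simp
    then show ?thesis using 2 S node_weight_pos[OF pos uv] by (auto simp: \<phi>_def)
  next
    \<comment> \<open>Only here is the restriction on rungs used: on side \<open>b\<close>, a rung
      above level \<open>i\<close> would have to pay for a rise from 0 to \<open>T\<close>. The two
      rungs at level \<open>i\<close> are tight.\<close>
    case (3 j c)
    then have "j \<le> i" using r by simp
    have "0 < out_cost w c j" "0 < in_cost w c j"
      using 3 by (auto intro: out_cost_pos[OF pos] in_cost_pos[OF pos])
    then show ?thesis using 3 S T \<open>j \<le> i\<close> node_weight_pos[OF pos uv]
      by (auto simp: \<phi>_def S_def T_def)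
  next
    case (4 j c)
    have "0 < in_cost w (\<not> c) j" "0 < in_cost w c (Suc j)"
      using 4 by (auto intro!: in_cost_pos[OF pos] simp del: in_cost.simps)
    then show ?thesis using 4 S T node_weight_pos[OF pos uv]
      by (auto simp: \<phi>_def)
  next
    case (5 c)
    then show ?thesis using T node_weight_pos[OF pos uv] by (simp add: \<phi>_def)
  qed
  have "\<phi> (from_nat (to_nat (In (\<not> b) i))) \<le>
    \<phi> (from_nat (to_nat (Out b i))) + ladder.awalk_cost w p"
  proof (rule ladder.potential_le_awalk_cost[OF p, where \<phi> = "\<lambda>x. \<phi> (from_nat x)"])
    fix e assume e: "e \<in> set p"
    then have "e \<in> parcs (ladder k)" using p by auto
    then obtain u v where uv: "e = (to_nat u, to_nat v)" "ladder_arc k u v"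
      by (rule parcs_ladderE)
    then show "\<phi> (from_nat (snd e)) \<le> \<phi> (from_nat (fst e)) + w e"
      using step[OF uv(2)] low e by (auto simp: node_weight_def)
  qed
  then show ?thesis by (simp add: \<phi>_def T_def S_def)
qed

section \<open>Doubling of tour costs\<close>

text \<open>Because the incoming chains switch sides, the route over the rung \<open>b (i+1)\<close>
  ends at \<open>In (\<not> b) i\<close>. It competes there with the route through
  \<open>Root\<close>, which uses both rungs of level \<open>i\<close>.\<close>

lemma tour_cost_step:
  assumes \<alpha>: "\<alpha> \<ge> 1" and i: "i < k"
    and pres: "ladder.shortest_paths_preserving k \<alpha> (steep_weight \<alpha>) w"
  shows "tour_cost w b i + tour_cost w (\<not> b) i < tour_cost w b (Suc i)"
proof -
  let ?u = "to_nat (Out b i)" and ?v = "to_nat (In (\<not> b) i)"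
  have pos: "ladder.positive_weights k w"
    and approx: "\<And>p. ladder.shortest_path k w ?u p ?v \<Longrightarrow>
      ladder.approx_shortest_path k \<alpha> (steep_weight \<alpha>) ?u p ?v"
    using pres by (auto simp: ladder.shortest_paths_preserving_def)
  \<comment> \<open>A shortest path in H costs in G at most \<alpha> times the route through
    \<open>Root\<close>, and a single rung above level \<open>i\<close> already exceeds
    that.\<close>
  have low: "j \<le> i" if p: "ladder.shortest_path k w ?u p ?v"
    and e: "(to_nat (Out c j), to_nat (In c j)) \<in> set p" for p c j
  proof (rule ccontr)
    assume "\<not> j \<le> i"
    obtain q where q: "ladder.awalk k ?u q ?v"
      "ladder.awalk_cost (steep_weight \<alpha>) q = 2 * (5 * \<alpha>) ^ Suc i + 2 * (1 + real i)"
      using cross_walk[of i k b "steep_weight \<alpha>"] i unfolding steep_cost by auto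
    have "ladder.apath k ?u p ?v"
      using p by (simp add: ladder.shortest_path_def)
    then have "set p \<subseteq> parcs (ladder k)"
      by (auto simp: ladder.apath_def)
    then have "(5 * \<alpha>) ^ Suc j \<le> ladder.awalk_cost (steep_weight \<alpha>) p"
      using ladder.arc_weight_le_awalk_cost[OF steep_weight_pos[OF \<alpha>] _ e]
        steep_cost(3)[of \<alpha> c j c j] by (simp add: node_weight_def)
    moreover have "ereal (ladder.awalk_cost (steep_weight \<alpha>) p) \<le>
      ereal \<alpha> * ladder.\<mu> k (steep_weight \<alpha>) ?u ?v"
      using approx[OF p] by (simp add: ladder.approx_shortest_path_def)
    moreover have "\<dots> \<le> ereal \<alpha> * ereal (ladder.awalk_cost (steep_weight \<alpha>) q)"
      using \<alpha> by (intro ereal_mult_left_mono ladder.min_cost_le_walk_cost[OF q(1)]) auto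
    ultimately have "(5 * \<alpha>) ^ Suc j \<le> \<alpha> * (2 * (5 * \<alpha>) ^ Suc i + 2 * (1 + real i))"
      unfolding q(2) by (metis ereal_less_eq(3) order_trans times_ereal.simps(1))
    with steep_rung_dominates[OF \<alpha>, of i j] \<open>\<not> j \<le> i\<close> show False by simp
  qed
  \<comment> \<open>Were the detour a shortest path in \<open>H\<close>, it would have to be cheap in \<open>G\<close>; this also excludes ties.\<close>
  let ?d = "[(?u, to_nat (Out b (Suc i))), (to_nat (Out b (Suc i)), to_nat (In b (Suc i))),
    (to_nat (In b (Suc i)), ?v)]"
  have d: "ladder.apath k ?u ?d ?v"
    using i by (auto simp: ladder.apath_simps ladder_arc.intros)
  obtain p where p: "ladder.apath k ?u p ?v"
    "ladder.\<mu> k w ?u ?v = ereal (ladder.awalk_cost w p)"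
  proof -
    have "?u \<rightarrow>\<^sup>*\<^bsub>with_proj (ladder k)\<^esub> ?v"
      using d by (auto simp: ladder.apath_def ladder.reachable_awalk)
    then show ?thesis
      using ladder.min_cost_awalk[of k ?u ?v w] pos that
      by (auto simp: ladder.positive_weights_def less_imp_le)
  qed
  have sp: "ladder.shortest_path k w ?u p ?v"
    using p by (simp add: ladder.shortest_path_def)
  have "ereal (ladder.awalk_cost w p) \<le> ereal (ladder.awalk_cost w ?d)"
    using d unfolding p(2)[symmetric] ladder.apath_def
    by (intro ladder.min_cost_le_walk_cost) blast
  moreover have "ladder.awalk_cost w p \<noteq> ladder.awalk_cost w ?d"
  proof
    assume "ladder.awalk_cost w p = ladder.awalk_cost w ?d"
    then have "ladder.shortest_path k w ?u ?d ?v"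
      using d p by (simp add: ladder.shortest_path_def)
    from low[OF this, of b "Suc i"] show False by simp
  qed
  ultimately have "ladder.awalk_cost w p < ladder.awalk_cost w ?d" by simp
  moreover have "ladder.awalk k ?u p ?v" using p by (simp add: ladder.apath_def)
  then have "node_weight w (Out b i) (In b i) + in_cost w b i + out_cost w (\<not> b) i +
    node_weight w (Out (\<not> b) i) (In (\<not> b) i) \<le> ladder.awalk_cost w p"
    using i low[OF sp] by (intro cross_cost_le[OF pos]) auto
  \<comment> \<open>Adding \<open>out_cost w b i + in_cost w (\<not> b) i\<close> to both sides
    closes the two routes up: the route through \<open>Root\<close> becomes both tours of level
    \<open>i\<close>, the detour becomes the one tour of level \<open>i + 1\<close>.\<close>
  ultimately show ?thesis
    by (simp add: tour_cost_def node_weight_def)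
qed

text \<open>A tour of level 0 has three arcs of weight at least \<open>m\<close>. The induction
  covers both sides \<open>b\<close> simultaneously, as each step adds up the tours of both.\<close>

lemma tour_cost_ge:
  assumes "\<alpha> \<ge> 1" and "ladder.shortest_paths_preserving k \<alpha> (steep_weight \<alpha>) w"
    and "\<And>u v. ladder_arc k u v \<Longrightarrow> m \<le> node_weight w u v" and "i \<le> k"
  shows "2 ^ i * (3 * m) \<le> tour_cost w b i"
  using assms(4)
proof (induction i arbitrary: b)
  case 0
  have "m \<le> node_weight w Root (Out b 0)" "m \<le> node_weight w (Out b 0) (In b 0)"
    "m \<le> node_weight w (In b 0) Root"
    by (auto intro: assms(3) ladder_arc.intros)
  then show ?case by (simp add: tour_cost_def)
next
  case (Suc i)
  then have "2 ^ i * (3 * m) \<le> tour_cost w b i" "2 ^ i * (3 * m) \<le> tour_cost w (\<not> b) i"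
    by auto
  then show ?case
    using Suc.prems tour_cost_step[OF assms(1) _ assms(2), of i b] by simp
qed

section \<open>From tour costs to the aspect ratio\<close>

lemma out_cost_le:
  assumes "\<And>u v. ladder_arc k u v \<Longrightarrow> node_weight w u v \<le> m" and "i \<le> k"
  shows "out_cost w b i \<le> (real i + 1) * m"
  using assms(2)
proof (induction i)
  case (Suc i)
  then show ?case
    using assms(1)[of "Out b i" "Out b (Suc i)"] by (simp add: ladder_arc.intros algebra_simps)
qed (use assms(1) in \<open>simp add: ladder_arc.intros\<close>)

lemma in_cost_le:
  assumes "\<And>u v. ladder_arc k u v \<Longrightarrow> node_weight w u v \<le> m" and "i \<le> k"
  shows "in_cost w b i \<le> (real i + 1) * m"
  using assms(2)
proof (induction i arbitrary: b)
  case (Suc i)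
  then have "in_cost w (\<not> b) i \<le> (real i + 1) * m"
    by simp
  then show ?case
    using Suc.prems assms(1)[of "In b (Suc i)" "In (\<not> b) i"]
    by (simp add: ladder_arc.intros algebra_simps)
qed (use assms(1) in \<open>simp add: ladder_arc.intros\<close>)

lemma tour_cost_le:
  assumes "\<And>u v. ladder_arc k u v \<Longrightarrow> node_weight w u v \<le> m" and "i \<le> k"
  shows "tour_cost w b i \<le> (2 * real i + 3) * m"
  using out_cost_le[OF assms, of b] in_cost_le[OF assms, of b]
    assms(1)[of "Out b i" "In b i"] assms(2)
  by (simp add: tour_cost_def ladder_arc.intros algebra_simps)

lemma parcs_ladder_nonempty: "parcs (ladder k) \<noteq> {}"
  using parcs_ladder_iff[of Root "Out True 0" k] ladder_arc.intros(1) by blast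

text \<open>One tour of level \<open>k\<close> is bounded from below through the least weight and
  from above through the greatest one.\<close>

lemma aspect_ratio_ladder_ge:
  assumes \<alpha>: "\<alpha> \<ge> 1" and pres: "ladder.shortest_paths_preserving k \<alpha> (steep_weight \<alpha>) w"
  shows "3 * 2 ^ k \<le> (2 * real k + 3) * ladder.aspect_ratio k w"
proof -
  define lo where "lo = (MIN e \<in> parcs (ladder k). w e)"
  define hi where "hi = (MAX e \<in> parcs (ladder k). w e)"
  have pos: "ladder.positive_weights k w"
    using pres by (simp add: ladder.shortest_paths_preserving_def)
  have fin: "finite (w ` parcs (ladder k))" "w ` parcs (ladder k) \<noteq> {}"
    using parcs_ladder_nonempty ladder.pair_finite_arcs by auto
  have lo: "0 < lo"
    using Min_in[OF fin] pos by (auto simp: lo_def ladder.positive_weights_def)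
  have "lo \<le> node_weight w u v" "node_weight w u v \<le> hi" if "ladder_arc k u v" for u v
    unfolding lo_def hi_def node_weight_def
    using that fin by (auto intro!: Min_le Max_ge)
  then have "2 ^ k * (3 * lo) \<le> tour_cost w True k"
    "tour_cost w True k \<le> (2 * real k + 3) * hi"
    using tour_cost_ge[OF \<alpha> pres, of lo k] tour_cost_le[of k w hi k] by auto
  then have "3 * 2 ^ k * lo \<le> (2 * real k + 3) * hi" by simp
  then have "3 * 2 ^ k \<le> (2 * real k + 3) * (hi / lo)"
    using lo by (simp add: field_simps)
  then show ?thesis by (simp add: ladder.aspect_ratio_def lo_def hi_def)
qed

text \<open>With k = 2m, half of the exponent absorbs the linear factor, since 4m + 3 \<le> 6 * 2^m;
  what remains is 2^m / 2.\<close>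

lemma powr_le_of_ladder_bound:
  fixes r :: real
  assumes "3 * 2 ^ (2 * m) \<le> (2 * real (2 * m) + 3) * r" and "m \<ge> 3"
  shows "2 powr (1 / 16 * real (4 * (2 * m) + 5)) \<le> r"
proof -
  have "real (Suc m) \<le> real (2 ^ m)"
    unfolding of_nat_le_iff by (rule Suc_leI) (rule less_exp)
  then have "1 + real m \<le> 2 ^ m" by simp
  have "0 < (2 * real (2 * m) + 3) * r"
    using assms(1) by (rule less_le_trans[rotated]) simp
  then have "0 < r" by (rule zero_less_mult_pos) simp
  have "3 * 2 ^ m * 2 ^ m \<le> (2 * real (2 * m) + 3) * r"
    using assms(1) by (simp only: power_add[symmetric] mult_2[symmetric] mult.assoc)
  also have "\<dots> \<le> (6 * 2 ^ m) * r"
    using \<open>0 < r\<close> \<open>1 + real m \<le> 2 ^ m\<close> by (intro mult_right_mono) auto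
  finally have "2 ^ m / 2 \<le> r" by (simp add: field_simps)
  \<comment> \<open>For n = 8m + 5, the inequality n / 16 \<le> m - 1 amounts to 8m \<ge> 21, hence
    m \<ge> 3.\<close>
  have "2 powr (1 / 16 * real (4 * (2 * m) + 5)) \<le> 2 powr (real m - 1)"
    using assms(2) by (intro powr_mono) (auto simp: field_simps)
  also have "\<dots> = 2 ^ m / 2"
    by (simp add: powr_diff powr_realpow)
  finally show ?thesis using \<open>2 ^ m / 2 \<le> r\<close> by simp
qed

theorem theorem1p7:
  shows "\<exists>c::real. c > 0 \<and>
    (\<forall>\<alpha>::real. \<alpha> \<ge> 1 \<longrightarrow>
      (\<exists>\<^sub>\<infinity>n::nat. \<exists>(G :: nat pair_pre_digraph) (w\<^sub>G :: (nat \<times> nat) weight_fun).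
        pair_digraph G \<and> card (pverts G) = n \<and> parcs G \<noteq> {} \<and>
        wf_digraph.positive_weights (with_proj G) w\<^sub>G \<and>
        (\<forall>w\<^sub>H :: (nat \<times> nat) weight_fun.
          wf_digraph.shortest_paths_preserving (with_proj G) \<alpha> w\<^sub>G w\<^sub>H \<longrightarrow>
          wf_digraph.aspect_ratio (with_proj G) w\<^sub>H \<ge> 2 powr (c * real n))))"
\<comment> \<open>The constant can be fixed before \<alpha>, because \<alpha> enters only the
  weights of G and neither the ladder nor the final bound.\<close>
proof (intro exI[of _ "1 / 16"] conjI allI impI)
  fix \<alpha> :: real
  assume \<alpha>: "\<alpha> \<ge> 1"
  let ?P = "\<lambda>n. \<exists>(G :: nat pair_pre_digraph) (w\<^sub>G :: (nat \<times> nat) weight_fun).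
        pair_digraph G \<and> card (pverts G) = n \<and> parcs G \<noteq> {} \<and>
        wf_digraph.positive_weights (with_proj G) w\<^sub>G \<and>
        (\<forall>w\<^sub>H :: (nat \<times> nat) weight_fun.
          wf_digraph.shortest_paths_preserving (with_proj G) \<alpha> w\<^sub>G w\<^sub>H \<longrightarrow>
          wf_digraph.aspect_ratio (with_proj G) w\<^sub>H \<ge> 2 powr (1 / 16 * real n))"
  show "\<exists>\<^sub>\<infinity>n. ?P n"
    unfolding INFM_nat
  proof
    fix N :: nat
    define m where "m = N + 3"
    have "m \<ge> 3" by (simp add: m_def)
    have "?P (4 * (2 * m) + 5)"
    proof (intro exI conjI allI impI)
      show "ladder.positive_weights (2 * m) (steep_weight \<alpha>)"
        using \<alpha> by (rule steep_weight_pos)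
    next
      fix w\<^sub>H
      assume "ladder.shortest_paths_preserving (2 * m) \<alpha> (steep_weight \<alpha>) w\<^sub>H"
      from aspect_ratio_ladder_ge[OF \<alpha> this]
      show "2 powr (1 / 16 * real (4 * (2 * m) + 5)) \<le> ladder.aspect_ratio (2 * m) w\<^sub>H"
        using \<open>m \<ge> 3\<close> by (rule powr_le_of_ladder_bound)
    qed (fact ladder.pair_digraph card_pverts_ladder parcs_ladder_nonempty)+
    moreover have "N < 4 * (2 * m) + 5" by (simp add: m_def)
    ultimately have "N < 4 * (2 * m) + 5 \<and> ?P (4 * (2 * m) + 5)" by (intro conjI)
    then show "\<exists>n>N. ?P n" by (rule exI)
  qed
qed simp

end
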